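(* Let $m$ and $n$ be integers with $m>n>1$, let $\mathbf{X}\in\mathbb{R}^{m\times n}$ be a matrix with columns $\mathbf{x}_1,\ldots,\mathbf{x}_n\in\mathbb{R}^m$, and let $\epsilon>0$. For $j\in\{1,\ldots,n\}$ let $\eta_j$ be the $\epsilon$-Frobenius entropy of the first $j$ columns of $\mathbf{X}$. Then the $\epsilon$-Frobenius entropy is a strictly increasing function of the time index, that is, $\eta_{j+1}>\eta_j$ for all $j\in\{1,\ldots,n-1\}$, if and only if $\Vert\mathbf{x}_j-\mathbf{x}_k\Vert\geq\epsilon$ for all distinct $j,k\in\{1,\ldots,n\}$.
   Context: $\Vert\cdot\Vert$ is the Euclidean norm on $\mathbb{R}^m$ and $\Vert\cdot\Vert_{\mathrm{F}}$ is the Frobenius norm. The recurrence matrix $\mathbf{R}_\epsilon\in\{0,1\}^{n\times n}$ associated with $\mathbf{X}$ and $\epsilon$ has entries $\mathbf{R}_\epsilon(i,j)=1$ if $\Vert\mathbf{x}_i-\mathbf{x}_j\Vert<\epsilon$ and $\mathbf{R}_\epsilon(i,j)=0$ otherwise. For $j\in\{1,\ldots,n\}$, let $\mathbf{R}_\epsilon(1:j,1:j)$ denote the leading $j\times j$ block. The $\epsilon$-Frobenius potential of the first $j$ columns is $v_j=\frac{1}{j^2}\Vert\mathbf{R}_\epsilon(1:j,1:j)\Vert_{\mathrm{F}}^2$, and the $\epsilon$-Frobenius entropy of the first $j$ columns is $\eta_j=-\log v_j$. *)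

theory Defs
  imports
    "HOL-Analysis.L2_Norm"
    "Jordan_Normal_Form.DL_Submatrix"
begin

text \<open>
  Matrices and vectors are indexed from 0, so the column written \<open>x\<^sub>j\<close> on paper
  is \<open>col X (j - 1)\<close>. The argument \<open>j\<close> of the block, potential and entropy below counts
  columns and therefore ranges over \<open>{1..n}\<close>.
\<close>

definition euclidean_norm :: "real vec \<Rightarrow> real" where
  "euclidean_norm v = L2_set (\<lambda>i. v $ i) {..<dim_vec v}"

definition frobenius_norm :: "real mat \<Rightarrow> real" where
  "frobenius_norm A = L2_set (\<lambda>ij. A $$ ij) ({..<dim_row A} \<times> {..<dim_col A})"

definition recurrence_matrix :: "real mat \<Rightarrow> real \<Rightarrow> real mat" where
  "recurrence_matrix X \<epsilon> = mat (dim_col X) (dim_col X)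
     (\<lambda>(i, j). if euclidean_norm (col X i - col X j) < \<epsilon> then 1 else 0)"

definition leading_block :: "'a mat \<Rightarrow> nat \<Rightarrow> 'a mat" where
  "leading_block A j = submatrix A {..<j} {..<j}"

definition frobenius_potential :: "real mat \<Rightarrow> real \<Rightarrow> nat \<Rightarrow> real" where
  "frobenius_potential X \<epsilon> j =
     1 / (real j)\<^sup>2 * (frobenius_norm (leading_block (recurrence_matrix X \<epsilon>) j))\<^sup>2"

definition frobenius_entropy :: "real mat \<Rightarrow> real \<Rightarrow> nat \<Rightarrow> real" where
  "frobenius_entropy X \<epsilon> j = - ln (frobenius_potential X \<epsilon> j)"

end

theory Submission
  imports Defs
begin

text \<open>
  Let \<open>N j\<close> be the number of ones in the leading \<open>j\<close> by \<open>j\<close> block, so that the potential is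
  \<open>N j / j\<^sup>2\<close>. By symmetry and the ones on the diagonal, \<open>N (j + 1) = N j + 1 + 2 * d j\<close>, where
  \<open>d j\<close> counts the earlier columns close to the new one. If \<open>N j = j\<close>, then the potential
  decreases strictly at \<open>j\<close> iff \<open>2 * j * d j < j + 1\<close>, that is, iff \<open>d j = 0\<close>, and in that case
  \<open>N (j + 1) = j + 1\<close>, so induction applies.
\<close>

text \<open>\<open>submatrix\<close> renumbers rows and columns through \<open>pick\<close>. An
  initial segment has no gaps, so no renumbering happens there and block entries keep their original
  indices.\<close>

lemma pick_lessThan:
  assumes "i < j"
  shows "pick {..<j} i = i"
  using assms
proof (induction i)
  case 0
  then show ?case by (auto intro: Least_equality)
next
  case (Suc i)
  then show ?case by (auto intro!: Least_equality)
qed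

lemma leading_block_eq_mat:
  assumes "A \<in> carrier_mat r c" and "j \<le> r" and "j \<le> c"
  shows "leading_block A j = mat j j (\<lambda>ij. A $$ ij)"
proof -
  have "{i. i < dim_row A \<and> i \<in> {..<j}} = {..<j}" "{i. i < dim_col A \<and> i \<in> {..<j}} = {..<j}"
    using assms by auto
  then have "leading_block A j = mat j j (\<lambda>(i, k). A $$ (pick {..<j} i, pick {..<j} k))"
    by (simp only: leading_block_def submatrix_def card_lessThan)
  also have "\<dots> = mat j j (\<lambda>ij. A $$ ij)"
    by (rule cong_mat) (simp_all only: prod.case pick_lessThan)
  finally show ?thesis .
qed

lemma euclidean_norm_minus_commute:
  assumes "dim_vec u = dim_vec v"
  shows "euclidean_norm (u - v) = euclidean_norm (v - u)"
  using assms unfolding euclidean_norm_def L2_set_def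
  by (auto simp: power2_commute intro!: sum.cong)

lemma euclidean_norm_minus_self [simp]: "euclidean_norm (v - v) = 0"
  by (simp add: euclidean_norm_def L2_set_def)

lemma frobenius_norm_mat_sq:
  "(frobenius_norm (mat r c f))\<^sup>2 = (\<Sum>i<r. \<Sum>k<c. (f (i, k))\<^sup>2)"
  by (auto simp: frobenius_norm_def L2_set_def sum_nonneg sum.cartesian_product intro!: sum.cong)

text \<open>Entries are 0 or 1, so squaring leaves them unchanged. The sum is kept in the naturals
  so that later steps can count exactly.\<close>

lemma frobenius_potential_eq_sum:
  assumes "X \<in> carrier_mat m n" and "j \<le> n"
  shows "frobenius_potential X \<epsilon> j =
    real (\<Sum>i<j. \<Sum>k<j. of_bool (euclidean_norm (col X i - col X k) < \<epsilon>)) / (real j)\<^sup>2"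
proof -
  have "leading_block (recurrence_matrix X \<epsilon>) j =
      mat j j (\<lambda>ij. recurrence_matrix X \<epsilon> $$ ij)"
    using assms by (intro leading_block_eq_mat) (auto simp: recurrence_matrix_def)
  then have "frobenius_potential X \<epsilon> j =
      (\<Sum>i<j. \<Sum>k<j. (recurrence_matrix X \<epsilon> $$ (i, k))\<^sup>2) / (real j)\<^sup>2"
    by (simp add: frobenius_potential_def frobenius_norm_mat_sq)
  also have "(\<Sum>i<j. \<Sum>k<j. (recurrence_matrix X \<epsilon> $$ (i, k))\<^sup>2) =
      (\<Sum>i<j. \<Sum>k<j. real (of_bool (euclidean_norm (col X i - col X k) < \<epsilon>)))"
    using assms by (intro sum.cong refl) (auto simp: recurrence_matrix_def)
  finally show ?thesis by simp
qed

lemma sum_square_Suc: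
  fixes c :: "nat \<Rightarrow> nat \<Rightarrow> nat"
  assumes "\<And>k. k < j \<Longrightarrow> c k j = c j k"
  shows "(\<Sum>i<Suc j. \<Sum>k<Suc j. c i k) = (\<Sum>i<j. \<Sum>k<j. c i k) + 2 * (\<Sum>k<j. c j k) + c j j"
  using assms by (simp add: sum.distrib)

lemma potential_step_iff:
  fixes j d :: nat
  assumes "j \<ge> 1"
  shows "real (j + 2 * d + 1) / (real (j + 1))\<^sup>2 < real j / (real j)\<^sup>2 \<longleftrightarrow> d = 0"
proof -
  have "x / y < 1 / z \<longleftrightarrow> x * z < y" if "y > 0" "z > 0" for x y z :: real
    using that by (simp add: field_simps)
  moreover have "real j / (real j)\<^sup>2 = 1 / real j"
    by (simp add: power2_eq_square)
  ultimately have "real (j + 2 * d + 1) / (real (j + 1))\<^sup>2 < real j / (real j)\<^sup>2 \<longleftrightarrow>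
      real (j + 2 * d + 1) * real j < (real (j + 1))\<^sup>2"
    using assms by simp
  also have "\<dots> \<longleftrightarrow> (j + 2 * d + 1) * j < (j + 1)\<^sup>2"
    unfolding of_nat_mult [symmetric] of_nat_power [symmetric] of_nat_less_iff ..
  also have "\<dots> \<longleftrightarrow> 2 * (d * j) < j + 1"
    by (simp add: power2_eq_square algebra_simps)
  also have "\<dots> \<longleftrightarrow> d = 0"
  \<comment> \<open>A positive \<open>d\<close> would give 2 * j \<le> 2 * (d * j) < j + 1, hence j
    < 1.\<close>
  proof (cases d)
    case (Suc e)
    then have "j \<le> d * j" by simp
    then show ?thesis using Suc assms by linarith
  qed simp
  finally show ?thesis .
qed

text \<open>Each enlargement of the block then adds only its diagonal one.\<close>

lemma sum_square_eq_if_off_diagonal_zero: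
  fixes c :: "nat \<Rightarrow> nat \<Rightarrow> nat"
  assumes "\<And>i k. i < n \<Longrightarrow> k < n \<Longrightarrow> c i k = c k i" and "\<And>i. i < n \<Longrightarrow> c i i = 1"
    and "\<And>i k. k < i \<Longrightarrow> i < j \<Longrightarrow> c i k = 0" and "j \<le> n"
  shows "(\<Sum>i<j. \<Sum>k<j. c i k) = j"
  using assms(3,4)
proof (induction j)
  case (Suc j)
  have "(\<Sum>i<Suc j. \<Sum>k<Suc j. c i k) = (\<Sum>i<j. \<Sum>k<j. c i k) + 2 * (\<Sum>k<j. c j k) + c j j"
    using Suc.prems assms(1) by (intro sum_square_Suc) auto
  then show ?case using Suc assms(2) by simp
qed simp

text \<open>Stated for an abstract symmetric array with unit diagonal, which separates the counting
  from the geometry of the columns.\<close>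

lemma potential_decreasing_iff:
  fixes c :: "nat \<Rightarrow> nat \<Rightarrow> nat"
  defines "v \<equiv> \<lambda>j. real (\<Sum>i<j. \<Sum>k<j. c i k) / (real j)\<^sup>2"
  assumes sym: "\<And>i k. i < n \<Longrightarrow> k < n \<Longrightarrow> c i k = c k i"
    and diag: "\<And>i. i < n \<Longrightarrow> c i i = 1"
  shows "(\<forall>j\<in>{1..n - 1}. v (j + 1) < v j) \<longleftrightarrow> (\<forall>i<n. \<forall>k<i. c i k = 0)"
proof -
  have step: "v (j + 1) < v j \<longleftrightarrow> (\<forall>k<j. c j k = 0)"
    if "1 \<le> j" "j < n" and zero: "\<And>i k. k < i \<Longrightarrow> i < j \<Longrightarrow> c i k = 0" for j
  proof -
    have N: "(\<Sum>i<j. \<Sum>k<j. c i k) = j"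
      using that by (intro sum_square_eq_if_off_diagonal_zero [of n] sym diag zero) auto
    have "(\<Sum>i<j + 1. \<Sum>k<j + 1. c i k) =
        (\<Sum>i<j. \<Sum>k<j. c i k) + 2 * (\<Sum>k<j. c j k) + c j j"
      using sum_square_Suc [of j c] sym that by simp
    then have "v (j + 1) = real (j + 2 * (\<Sum>k<j. c j k) + 1) / (real (j + 1))\<^sup>2"
      using N diag that by (simp only: v_def)
    moreover have "v j = real j / (real j)\<^sup>2"
      using N by (simp only: v_def)
    ultimately have "v (j + 1) < v j \<longleftrightarrow> (\<Sum>k<j. c j k) = 0"
      by (simp only: potential_step_iff [OF that(1)])
    then show ?thesis by auto
  qed
  show ?thesis
  proof
    assume dec: "\<forall>j\<in>{1..n - 1}. v (j + 1) < v j"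
    have "\<forall>k<i. c i k = 0" if "i < n" for i
      using that
    \<comment> \<open>The induction hypothesis says that all rows before \<open>i\<close> vanish
      left of the diagonal, which is the premise \<open>zero\<close> of \<open>step\<close>; the
      decrease at \<open>i\<close> then clears row \<open>i\<close>. Row 0 has nothing left of the
      diagonal.\<close>
    proof (induction i rule: less_induct)
      case (less i)
      show ?case
      proof (cases "i = 0")
        case False
        then show ?thesis using step [of i] less dec by auto
      qed simp
    qed
    then show "\<forall>i<n. \<forall>k<i. c i k = 0" by blast
  next
    assume zero: "\<forall>i<n. \<forall>k<i. c i k = 0"
    show "\<forall>j\<in>{1..n - 1}. v (j + 1) < v j"
    proof
      fix j
      assume "j \<in> {1..n - 1}"
      then have "1 \<le> j" "j < n" by auto
      then show "v (j + 1) < v j" using step [of j] zero by auto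
    qed
  qed
qed

theorem theorem3p2:
  fixes m n :: nat and X :: "real mat" and \<epsilon> :: real
  assumes "m > n" and "n > 1"
    and "X \<in> carrier_mat m n"
    and "\<epsilon> > 0"
  shows "(\<forall>j\<in>{1..n - 1}. frobenius_entropy X \<epsilon> (j + 1) > frobenius_entropy X \<epsilon> j) \<longleftrightarrow>
    (\<forall>j<n. \<forall>k<n. j \<noteq> k \<longrightarrow> euclidean_norm (col X j - col X k) \<ge> \<epsilon>)"
proof -
  define c :: "nat \<Rightarrow> nat \<Rightarrow> nat"
    where "c i k = of_bool (euclidean_norm (col X i - col X k) < \<epsilon>)" for i k
  define v where "v j = real (\<Sum>i<j. \<Sum>k<j. c i k) / (real j)\<^sup>2" for j
  have v: "frobenius_potential X \<epsilon> j = v j" if "j \<le> n" for j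
    using frobenius_potential_eq_sum [OF assms(3) that] by (simp add: v_def c_def)
  have diag: "c i i = 1" for i
    using assms(4) by (simp add: c_def)
  \<comment> \<open>No bound on the indices: \<open>col X i\<close> has dimension
    \<open>dim_row X\<close> for every \<open>i\<close>.\<close>
  have sym: "c i k = c k i" for i k
    unfolding c_def by (subst euclidean_norm_minus_commute) auto
  \<comment> \<open>Positivity makes \<open>ln\<close> strictly monotone on the potentials, so
    entropy increases exactly where \<open>v\<close> decreases. The diagonal entry at (0, 0) is the
    witness.\<close>
  have pos: "v j > 0" if "j \<ge> 1" for j
  proof -
    have "c 0 0 \<le> (\<Sum>k<j. c 0 k)"
      using that by (intro member_le_sum) auto
    also have "\<dots> \<le> (\<Sum>i<j. \<Sum>k<j. c i k)"
      using that by (intro member_le_sum [of 0 _ "\<lambda>i. \<Sum>k<j. c i k"]) auto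
    finally have "(\<Sum>i<j. \<Sum>k<j. c i k) > 0"
      using diag by simp
    then show ?thesis
      using that unfolding v_def by (intro divide_pos_pos) (simp_all only: of_nat_0_less_iff, simp)
  qed
  have "(\<forall>j\<in>{1..n - 1}. frobenius_entropy X \<epsilon> (j + 1) > frobenius_entropy X \<epsilon> j) \<longleftrightarrow>
      (\<forall>j\<in>{1..n - 1}. v (j + 1) < v j)"
    using assms(2) by (intro ball_cong refl) (auto simp: frobenius_entropy_def v pos)
  also have "\<dots> \<longleftrightarrow> (\<forall>i<n. \<forall>k<i. c i k = 0)"
    unfolding v_def by (intro potential_decreasing_iff sym diag)
  \<comment> \<open>Symmetry carries the vanishing below the diagonal to the pairs above it.\<close>
  also have "\<dots> \<longleftrightarrow> (\<forall>j<n. \<forall>k<n. j \<noteq> k \<longrightarrow> c j k = 0)"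
    by (metis less_trans nat_neq_iff sym)
  finally show ?thesis
    by (simp add: c_def not_less)
qed

end
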